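(* Let $R$ be a commutative ring with unity and let $S\subseteq R$ be a finite multiplicatively closed subset. Then $R$ is an $S$-integral domain if and only if the localization $S^{-1}R$ is an integral domain.
   Context: A multiplicatively closed subset $S$ of a commutative ring $R$ is a subset with $1\in S$, $0\notin S$, and $st\in S$ for all $s,t\in S$. The ring $R$ is an $S$-integral domain if there exists $s\in S$ such that for all $a,b\in R$ with $ab=0$, either $sa=0$ or $sb=0$. *)

theory Defs
  imports "HOL-Algebra.Ring"
begin

definition mult_closed_subset :: "('a, 'm) ring_scheme \<Rightarrow> 'a set \<Rightarrow> bool" where
  "mult_closed_subset R S \<longleftrightarrow> submonoid S R \<and> \<zero>\<^bsub>R\<^esub> \<notin> S"

definition S_integral_domain :: "('a, 'm) ring_scheme \<Rightarrow> 'a set \<Rightarrow> bool" where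
  "S_integral_domain R S \<longleftrightarrow>
     (\<exists>s\<in>S. \<forall>a\<in>carrier R. \<forall>b\<in>carrier R. a \<otimes>\<^bsub>R\<^esub> b = \<zero>\<^bsub>R\<^esub> \<longrightarrow>
        s \<otimes>\<^bsub>R\<^esub> a = \<zero>\<^bsub>R\<^esub> \<or> s \<otimes>\<^bsub>R\<^esub> b = \<zero>\<^bsub>R\<^esub>)"

definition frac_rel :: "('a, 'm) ring_scheme \<Rightarrow> 'a set \<Rightarrow> (('a \<times> 'a) \<times> ('a \<times> 'a)) set" where
  "frac_rel R S =
     {((a, s), (b, t)) | a s b t. a \<in> carrier R \<and> s \<in> S \<and> b \<in> carrier R \<and> t \<in> S \<and>
        (\<exists>u\<in>S. u \<otimes>\<^bsub>R\<^esub> (a \<otimes>\<^bsub>R\<^esub> t \<ominus>\<^bsub>R\<^esub> b \<otimes>\<^bsub>R\<^esub> s) = \<zero>\<^bsub>R\<^esub>)}"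

definition frac :: "('a, 'm) ring_scheme \<Rightarrow> 'a set \<Rightarrow> 'a \<Rightarrow> 'a \<Rightarrow> ('a \<times> 'a) set" where
  "frac R S a s = frac_rel R S `` {(a, s)}"

text \<open>The ring operations on classes are unions over all representatives; as the
  representative formulas respect the relation, each union is a single class
  (lemmas \<open>localization_add\<close> and \<open>localization_mult\<close>).\<close>

definition localization :: "('a, 'm) ring_scheme \<Rightarrow> 'a set \<Rightarrow> ('a \<times> 'a) set ring" where
  "localization R S =
     \<lparr>carrier = (carrier R \<times> S) // frac_rel R S,
      mult = (\<lambda>X Y. \<Union>(a, s)\<in>X. \<Union>(b, t)\<in>Y. frac R S (a \<otimes>\<^bsub>R\<^esub> b) (s \<otimes>\<^bsub>R\<^esub> t)),
      one = frac R S \<one>\<^bsub>R\<^esub> \<one>\<^bsub>R\<^esub>,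
      zero = frac R S \<zero>\<^bsub>R\<^esub> \<one>\<^bsub>R\<^esub>,
      add = (\<lambda>X Y. \<Union>(a, s)\<in>X. \<Union>(b, t)\<in>Y.
               frac R S (a \<otimes>\<^bsub>R\<^esub> t \<oplus>\<^bsub>R\<^esub> b \<otimes>\<^bsub>R\<^esub> s) (s \<otimes>\<^bsub>R\<^esub> t))\<rparr>"

context
  fixes R (structure) and S
  assumes R: "cring R" and S: "mult_closed_subset R S"
begin

interpretation cring R by (rule R)

lemma mult_closed_subset_simps:
  shows "S \<subseteq> carrier R" "\<And>s. s \<in> S \<Longrightarrow> s \<in> carrier R" "\<one> \<in> S"
    "\<And>s t. s \<in> S \<Longrightarrow> t \<in> S \<Longrightarrow> s \<otimes> t \<in> S" "\<zero> \<notin> S"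
  using S by (auto simp: mult_closed_subset_def submonoid_def)

private lemmas S' = mult_closed_subset_simps(2-4)

lemma frac_rel_iff:
  "((a, s), (b, t)) \<in> frac_rel R S \<longleftrightarrow>
     a \<in> carrier R \<and> s \<in> S \<and> b \<in> carrier R \<and> t \<in> S \<and>
     (\<exists>u\<in>S. u \<otimes> a \<otimes> t = u \<otimes> b \<otimes> s)"
proof -
  have "u \<otimes> (a \<otimes> t \<ominus> b \<otimes> s) = \<zero> \<longleftrightarrow> u \<otimes> a \<otimes> t = u \<otimes> b \<otimes> s"
    if "a \<in> carrier R" "s \<in> S" "b \<in> carrier R" "t \<in> S" "u \<in> S" for u
  proof -
    have c: "a \<in> carrier R" "s \<in> carrier R" "b \<in> carrier R" "t \<in> carrier R" "u \<in> carrier R"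
      using that S' by auto
    have "u \<otimes> (a \<otimes> t \<ominus> b \<otimes> s) = u \<otimes> a \<otimes> t \<ominus> u \<otimes> b \<otimes> s"
      using c by (simp add: minus_eq r_distr r_minus m_assoc)
    moreover have "u \<otimes> a \<otimes> t \<ominus> u \<otimes> b \<otimes> s = \<zero> \<longleftrightarrow> u \<otimes> a \<otimes> t = u \<otimes> b \<otimes> s"
      using c by (metis m_closed minus_eq minus_equality minus_minus r_neg a_inv_closed)
    ultimately show ?thesis by simp
  qed
  then show ?thesis unfolding frac_rel_def by blast
qed

lemma equiv_frac_rel: "equiv (carrier R \<times> S) (frac_rel R S)"
proof (rule equivI)
  show "frac_rel R S \<subseteq> (carrier R \<times> S) \<times> (carrier R \<times> S)"
    by (auto simp: frac_rel_def)
  show "refl_on (carrier R \<times> S) (frac_rel R S)"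
    using S'(2) by (auto simp: refl_on_def frac_rel_iff)
  show "sym (frac_rel R S)"
    by (rule symI) (force simp: frac_rel_iff)
  show "trans (frac_rel R S)"
  proof (rule transI, clarify)
    fix a s b t c r
    assume "((a, s), (b, t)) \<in> frac_rel R S" "((b, t), (c, r)) \<in> frac_rel R S"
    then obtain u v where m: "a \<in> carrier R" "b \<in> carrier R" "c \<in> carrier R" "s \<in> S" "t \<in> S" "r \<in> S"
        "u \<in> S" "v \<in> S"
      and e1: "u \<otimes> a \<otimes> t = u \<otimes> b \<otimes> s" and e2: "v \<otimes> b \<otimes> r = v \<otimes> c \<otimes> t"
      unfolding frac_rel_iff by blast
    have cs: "s \<in> carrier R" "t \<in> carrier R" "r \<in> carrier R" "u \<in> carrier R" "v \<in> carrier R"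
      using m S' by auto
    have "(u \<otimes> v \<otimes> t) \<otimes> a \<otimes> r = v \<otimes> r \<otimes> (u \<otimes> a \<otimes> t)"
      using cs m(1-3) by (simp add: m_ac)
    also have "\<dots> = u \<otimes> s \<otimes> (v \<otimes> b \<otimes> r)"
      unfolding e1 using cs m(1-3) by (simp add: m_ac)
    also have "\<dots> = (u \<otimes> v \<otimes> t) \<otimes> c \<otimes> s"
      unfolding e2 using cs m(1-3) by (simp add: m_ac)
    finally show "((a, s), (c, r)) \<in> frac_rel R S"
      unfolding frac_rel_iff using m S'(3) by blast
  qed
qed

lemma frac_eq_iff:
  assumes "a \<in> carrier R" "s \<in> S" "b \<in> carrier R" "t \<in> S"
  shows "frac R S a s = frac R S b t \<longleftrightarrow> (\<exists>u\<in>S. u \<otimes> a \<otimes> t = u \<otimes> b \<otimes> s)"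
  unfolding frac_def using equiv_frac_rel assms
  by (subst eq_equiv_class_iff[OF equiv_frac_rel]) (auto simp: frac_rel_iff)

lemma frac_closed: "a \<in> carrier R \<Longrightarrow> s \<in> S \<Longrightarrow> frac R S a s \<in> carrier (localization R S)"
  by (auto simp: localization_def frac_def intro: quotientI)

lemma localization_cases:
  assumes "X \<in> carrier (localization R S)"
  obtains a s where "a \<in> carrier R" "s \<in> S" "X = frac R S a s"
  using assms by (auto simp: localization_def frac_def elim!: quotientE)

lemma localization_mult:
  assumes "a \<in> carrier R" "s \<in> S" "b \<in> carrier R" "t \<in> S"
  shows "frac R S a s \<otimes>\<^bsub>localization R S\<^esub> frac R S b t = frac R S (a \<otimes> b) (s \<otimes> t)"
proof -
  have "(\<lambda>(a, s) (b, t). frac R S (a \<otimes> b) (s \<otimes> t)) respects2 frac_rel R S"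
  proof (rule congruent2I', clarify)
    fix a s b t c p d q
    assume "((a, s), (c, p)) \<in> frac_rel R S" "((b, t), (d, q)) \<in> frac_rel R S"
    then obtain u v where m: "a \<in> carrier R" "b \<in> carrier R" "c \<in> carrier R" "d \<in> carrier R"
        "s \<in> S" "t \<in> S" "p \<in> S" "q \<in> S" "u \<in> S" "v \<in> S"
      and e: "u \<otimes> a \<otimes> p = u \<otimes> c \<otimes> s" "v \<otimes> b \<otimes> q = v \<otimes> d \<otimes> t"
      unfolding frac_rel_iff by blast
    have cs: "s \<in> carrier R" "t \<in> carrier R" "p \<in> carrier R" "q \<in> carrier R"
      "u \<in> carrier R" "v \<in> carrier R"
      using m S' by auto
    have "(u \<otimes> v) \<otimes> (a \<otimes> b) \<otimes> (p \<otimes> q) = (u \<otimes> a \<otimes> p) \<otimes> (v \<otimes> b \<otimes> q)"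
      using cs m(1-4) by (simp add: m_ac)
    also have "\<dots> = (u \<otimes> v) \<otimes> (c \<otimes> d) \<otimes> (s \<otimes> t)"
      unfolding e using cs m(1-4) by (simp add: m_ac)
    finally show "frac R S (a \<otimes> b) (s \<otimes> t) = frac R S (c \<otimes> d) (p \<otimes> q)"
      using m S'(3) by (subst frac_eq_iff) auto
  qed
  from UN_equiv_class2[OF equiv_frac_rel equiv_frac_rel this, of "(a, s)" "(b, t)"] assms
  show ?thesis by (simp add: localization_def frac_def split_def)
qed

lemma localization_add:
  assumes "a \<in> carrier R" "s \<in> S" "b \<in> carrier R" "t \<in> S"
  shows "frac R S a s \<oplus>\<^bsub>localization R S\<^esub> frac R S b t
       = frac R S (a \<otimes> t \<oplus> b \<otimes> s) (s \<otimes> t)"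
proof -
  have "(\<lambda>(a, s) (b, t). frac R S (a \<otimes> t \<oplus> b \<otimes> s) (s \<otimes> t)) respects2 frac_rel R S"
  proof (rule congruent2I', clarify)
    fix a s b t c p d q
    assume "((a, s), (c, p)) \<in> frac_rel R S" "((b, t), (d, q)) \<in> frac_rel R S"
    then obtain u v where m: "a \<in> carrier R" "b \<in> carrier R" "c \<in> carrier R" "d \<in> carrier R"
        "s \<in> S" "t \<in> S" "p \<in> S" "q \<in> S" "u \<in> S" "v \<in> S"
      and e: "u \<otimes> a \<otimes> p = u \<otimes> c \<otimes> s" "v \<otimes> b \<otimes> q = v \<otimes> d \<otimes> t"
      unfolding frac_rel_iff by blast
    have cs: "s \<in> carrier R" "t \<in> carrier R" "p \<in> carrier R" "q \<in> carrier R"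
      "u \<in> carrier R" "v \<in> carrier R"
      using m S' by auto
    have "(u \<otimes> v) \<otimes> (a \<otimes> t \<oplus> b \<otimes> s) \<otimes> (p \<otimes> q)
        = (u \<otimes> a \<otimes> p) \<otimes> (v \<otimes> t \<otimes> q) \<oplus> (v \<otimes> b \<otimes> q) \<otimes> (u \<otimes> s \<otimes> p)"
      using cs m(1-4) by (simp add: m_ac l_distr r_distr)
    also have "\<dots> = (u \<otimes> v) \<otimes> (c \<otimes> q \<oplus> d \<otimes> p) \<otimes> (s \<otimes> t)"
      unfolding e using cs m(1-4) by (simp add: m_ac l_distr r_distr)
    finally show "frac R S (a \<otimes> t \<oplus> b \<otimes> s) (s \<otimes> t) = frac R S (c \<otimes> q \<oplus> d \<otimes> p) (p \<otimes> q)"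
      using m cs S'(3) by (subst frac_eq_iff) auto
  qed
  from UN_equiv_class2[OF equiv_frac_rel equiv_frac_rel this, of "(a, s)" "(b, t)"] assms
  show ?thesis by (simp add: localization_def frac_def split_def)
qed

lemma localization_zero: "\<zero>\<^bsub>localization R S\<^esub> = frac R S \<zero> \<one>"
  and localization_one: "\<one>\<^bsub>localization R S\<^esub> = frac R S \<one> \<one>"
  by (simp_all add: localization_def)

private lemma frac_eqI:
  assumes "a \<in> carrier R" "s \<in> S" "b \<in> carrier R" "t \<in> S" "a \<otimes> t = b \<otimes> s"
  shows "frac R S a s = frac R S b t"
  using assms S' by (subst frac_eq_iff) (auto intro!: bexI[of _ \<one>])

lemma cring_localization: "cring (localization R S)"
proof (rule cringI)
  note ops = localization_add localization_mult localization_zero localization_one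
  show "abelian_group (localization R S)"
  proof (rule abelian_groupI)
    fix X assume "X \<in> carrier (localization R S)"
    then obtain a s where X: "a \<in> carrier R" "s \<in> S" "X = frac R S a s"
      by (rule localization_cases)
    show "\<exists>Y\<in>carrier (localization R S). Y \<oplus>\<^bsub>localization R S\<^esub> X = \<zero>\<^bsub>localization R S\<^esub>"
    proof
      show "frac R S (\<ominus> a) s \<in> carrier (localization R S)"
        using X by (intro frac_closed) auto
      show "frac R S (\<ominus> a) s \<oplus>\<^bsub>localization R S\<^esub> X = \<zero>\<^bsub>localization R S\<^esub>"
        unfolding X(3) using X(1,2) S'
        by (simp add: ops l_minus l_neg) (rule frac_eqI, auto)
    qed
  qed (auto elim!: localization_cases
      simp: ops S' l_distr r_distr m_ac a_ac intro!: frac_closed frac_eqI)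
  show "comm_monoid (localization R S)"
    by (rule comm_monoidI) (auto elim!: localization_cases
      simp: ops S' l_distr r_distr m_ac a_ac intro!: frac_closed frac_eqI)
  fix X Y Z
  assume "X \<in> carrier (localization R S)" "Y \<in> carrier (localization R S)"
    "Z \<in> carrier (localization R S)"
  then obtain a s b t c r where
    m: "a \<in> carrier R" "s \<in> S" "b \<in> carrier R" "t \<in> S" "c \<in> carrier R" "r \<in> S"
    and X: "X = frac R S a s" and Y: "Y = frac R S b t" and Z: "Z = frac R S c r"
    by (elim localization_cases)
  show "(X \<oplus>\<^bsub>localization R S\<^esub> Y) \<otimes>\<^bsub>localization R S\<^esub> Z =
      X \<otimes>\<^bsub>localization R S\<^esub> Z \<oplus>\<^bsub>localization R S\<^esub> Y \<otimes>\<^bsub>localization R S\<^esub> Z"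
    unfolding X Y Z using m S'
    by (simp add: localization_add localization_mult, intro frac_eqI)
       (simp_all add: l_distr r_distr m_ac)
qed

end

end

theory Submission
  imports Defs
begin

text \<open>
  A fraction \<open>a/s\<close> vanishes exactly when some element of \<open>S\<close> kills \<open>a\<close>
  (lemma \<open>frac_eq_zero_iff\<close>). So \<open>S\<inverse>R\<close> is a domain as soon as \<open>ab = 0\<close> forces \<open>a\<close> or \<open>b\<close>
  to be killed by \<^emph>\<open>some\<close> element of \<open>S\<close>, whereas in an \<open>S\<close>-integral domain one
  \<^emph>\<open>fixed\<close> element of \<open>S\<close> does this for all pairs. The forward direction follows
  at once, and the converse rests on finiteness: the product of all elements of a finite \<open>S\<close>
  is a common multiple of them that lies in \<open>S\<close> (lemma \<open>ex_common_multiple\<close>), and it kills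
  everything that any element of \<open>S\<close> kills.
\<close>

context
  fixes R (structure) and S
  assumes R: "cring R" and S: "mult_closed_subset R S"
begin

interpretation cring R by (rule R)

private lemmas S_simps = mult_closed_subset_simps[OF R S]

lemma frac_eq_zero_iff:
  assumes "a \<in> carrier R" "s \<in> S"
  shows "frac R S a s = \<zero>\<^bsub>localization R S\<^esub> \<longleftrightarrow> (\<exists>u\<in>S. u \<otimes> a = \<zero>)"
  unfolding localization_zero[OF R S] using assms S_simps(2,3)
  by (subst frac_eq_iff[OF R S]) auto

text \<open>The set \<open>F\<close> is separated from \<open>S\<close> only so that the induction can
  multiply its elements together one at a time.\<close>

lemma ex_common_multiple:
  assumes "finite F" "F \<subseteq> S"
  shows "\<exists>m\<in>S. \<forall>u\<in>F. \<exists>c\<in>carrier R. m = c \<otimes> u"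
  using assms
proof (induction F rule: finite_induct)
  case empty
  then show ?case using S_simps(3) by auto
next
  case (insert v F)
  then obtain m where m: "m \<in> S" "\<forall>u\<in>F. \<exists>c\<in>carrier R. m = c \<otimes> u" by auto
  have v: "v \<in> S" using insert.prems by simp
  have "\<exists>c\<in>carrier R. m \<otimes> v = c \<otimes> u" if u: "u \<in> insert v F" for u
  proof (cases "u = v")
    case True
    then show ?thesis using m(1) S_simps(2) by auto
  next
    case False
    then obtain c where c: "c \<in> carrier R" "m = c \<otimes> u" using u m(2) by auto
    have "u \<in> S" using u insert.prems by auto
    then have "m \<otimes> v = (c \<otimes> v) \<otimes> u" using c v S_simps(2) by (simp add: m_ac)
    then show ?thesis using c(1) v S_simps(2) by blast
  qed
  then show ?case using m(1) v S_simps(4) by blast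
qed

lemma localization_one_not_zero: "\<one>\<^bsub>localization R S\<^esub> \<noteq> \<zero>\<^bsub>localization R S\<^esub>"
  unfolding localization_one[OF R S] using S_simps by (subst frac_eq_zero_iff) auto

lemma domain_localization_if_S_integral_domain:
  assumes "S_integral_domain R S"
  shows "domain (localization R S)"
proof -
  obtain m where m: "m \<in> S"
    and kills: "\<And>a b. a \<in> carrier R \<Longrightarrow> b \<in> carrier R \<Longrightarrow> a \<otimes> b = \<zero> \<Longrightarrow>
      m \<otimes> a = \<zero> \<or> m \<otimes> b = \<zero>"
    using assms unfolding S_integral_domain_def by blast
  interpret L: cring "localization R S" by (rule cring_localization[OF R S])
  show ?thesis
  proof (intro domain.intro domain_axioms.intro L.is_cring localization_one_not_zero)
    fix X Y
    assume XY: "X \<otimes>\<^bsub>localization R S\<^esub> Y = \<zero>\<^bsub>localization R S\<^esub>"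
      and "X \<in> carrier (localization R S)" "Y \<in> carrier (localization R S)"
    then obtain a s b t where el: "a \<in> carrier R" "s \<in> S" "b \<in> carrier R" "t \<in> S"
      and X: "X = frac R S a s" and Y: "Y = frac R S b t"
      by (metis localization_cases[OF R S])
    have "frac R S (a \<otimes> b) (s \<otimes> t) = \<zero>\<^bsub>localization R S\<^esub>"
      using XY el unfolding X Y by (simp add: localization_mult[OF R S])
    then obtain u where u: "u \<in> S" "u \<otimes> (a \<otimes> b) = \<zero>"
      using el S_simps(4) by (auto simp: frac_eq_zero_iff)
    \<comment> \<open>Absorb the annihilator of \<open>ab\<close> into the first factor, so that \<open>m\<close> applies.\<close>
    have "m \<otimes> (u \<otimes> a) = \<zero> \<or> m \<otimes> b = \<zero>"
      using u el S_simps(2) by (intro kills) (auto simp: m_assoc)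
    then have "(m \<otimes> u) \<otimes> a = \<zero> \<or> m \<otimes> b = \<zero>"
      using m u(1) el S_simps(2) by (simp add: m_assoc)
    then show "X = \<zero>\<^bsub>localization R S\<^esub> \<or> Y = \<zero>\<^bsub>localization R S\<^esub>"
      unfolding X Y using m u(1) el S_simps(4) by (auto simp: frac_eq_zero_iff)
  qed
qed

lemma S_integral_domain_if_domain_localization:
  assumes "finite S" "domain (localization R S)"
  shows "S_integral_domain R S"
proof -
  interpret L: domain "localization R S" by (rule assms(2))
  obtain m where m: "m \<in> S" and mult: "\<And>u. u \<in> S \<Longrightarrow> \<exists>c\<in>carrier R. m = c \<otimes> u"
    using ex_common_multiple[OF assms(1)] by blast
  have kills: "m \<otimes> a = \<zero>"
    if a: "a \<in> carrier R" and 0: "frac R S a \<one> = \<zero>\<^bsub>localization R S\<^esub>" for a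
  proof -
    obtain u where u: "u \<in> S" "u \<otimes> a = \<zero>"
      using 0 a S_simps(3) by (auto simp: frac_eq_zero_iff)
    obtain c where "c \<in> carrier R" "m = c \<otimes> u" using mult u(1) by blast
    then show ?thesis using u a S_simps(2) by (simp add: m_assoc)
  qed
  have "m \<otimes> a = \<zero> \<or> m \<otimes> b = \<zero>"
    if el: "a \<in> carrier R" "b \<in> carrier R" and ab: "a \<otimes> b = \<zero>" for a b
  proof -
    have "frac R S a \<one> \<otimes>\<^bsub>localization R S\<^esub> frac R S b \<one> = \<zero>\<^bsub>localization R S\<^esub>"
      using el ab S_simps(3) by (simp add: localization_mult[OF R S] localization_zero[OF R S])
    then have "frac R S a \<one> = \<zero>\<^bsub>localization R S\<^esub> \<or> frac R S b \<one> = \<zero>\<^bsub>localization R S\<^esub>"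
      using el S_simps(3) frac_closed[OF R S] by (intro L.integral) auto
    then show ?thesis using kills el by blast
  qed
  then show ?thesis using m unfolding S_integral_domain_def by blast
qed

end

theorem theorem2p13:
  fixes R :: "('a, 'm) ring_scheme" and S :: "'a set"
  assumes "cring R" and "mult_closed_subset R S" and "finite S"
  shows "S_integral_domain R S \<longleftrightarrow> domain (localization R S)"
  using domain_localization_if_S_integral_domain[OF assms(1,2)]
    S_integral_domain_if_domain_localization[OF assms] by blast

end
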